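(* Let $s\in(1,\infty)$ and let $r\in(1,\infty)$ be fixed. Define, for $p\in(0,1)$, $$f_{p|r,s}(p)=\frac{r-1}{\zeta(s)\,\Gamma(s)\,(1-p)^r}\int_p^1\frac{(\omega-p)^{r-2}(-\ln\omega)^{s-1}}{\omega^{r-1}}\,d\omega.$$ Then $f_{p|r,s}$ is a probability density function on $(0,1)$, and the $\mathrm{Zeta}(s)$ distribution is the mixture over $p$ of the $\mathrm{Negative\ Binomial}(r,p)$ distributions with mixing density $f_{p|r,s}$; that is, for every $x\in\{0,1,2,\ldots\}$, $$\int_0^1 \frac{\Gamma(r+x)}{\Gamma(r)\Gamma(x+1)}\,p^x(1-p)^r\, f_{p|r,s}(p)\,dp=\frac{(x+1)^{-s}}{\zeta(s)}.$$ Moreover, this mixing distribution is unique: if $\mu$ is a probability measure on $(0,1)$ such that $\int_{(0,1)} \frac{\Gamma(r+x)}{\Gamma(r)\Gamma(x+1)}p^x(1-p)^r\,\mu(dp)=\frac{(x+1)^{-s}}{\zeta(s)}$ for every $x\in\{0,1,2,\ldots\}$, then $\mu$ is the probability measure with density $f_{p|r,s}$.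
   Context: $\zeta(s)=\sum_{x=0}^{\infty}(x+1)^{-s}$ is the Riemann zeta function (for $s>1$) and $\Gamma$ is the Gamma function. The $\mathrm{Zeta}(s)$ distribution, $s\in(1,\infty)$, is the distribution on $\{0,1,2,\ldots\}$ with probability mass function $\frac{(x+1)^{-s}}{\zeta(s)}$. The $\mathrm{Negative\ Binomial}(r,p)$ distribution, $r\in(0,\infty)$, $p\in(0,1)$, is the distribution on $\{0,1,2,\ldots\}$ with probability mass function $\frac{\Gamma(r+x)}{\Gamma(r)\Gamma(x+1)}p^x(1-p)^r$. *)

theory Defs
  imports "HOL-Probability.Probability"
begin

definition real_zeta :: "real \<Rightarrow> real" where
  "real_zeta s = (\<Sum>x. (real x + 1) powr (- s))"

definition zeta_mass :: "real \<Rightarrow> nat \<Rightarrow> real" where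
  "zeta_mass s x = (real x + 1) powr (- s) / real_zeta s"

text \<open>The library's \<open>neg_binomial_pmf\<close> only covers natural number shape parameters (and counts
  with the roles of \<open>p\<close> and \<open>1 - p\<close> exchanged); here \<open>r\<close> is any positive real.\<close>

definition neg_binomial_mass :: "real \<Rightarrow> real \<Rightarrow> nat \<Rightarrow> real" where
  "neg_binomial_mass r p x =
     Gamma (r + real x) / (Gamma r * Gamma (real x + 1)) * p ^ x * (1 - p) powr r"

text \<open>Only the values for \<open>0 < p < 1\<close> are meaningful.\<close>

definition mixing_density :: "real \<Rightarrow> real \<Rightarrow> real \<Rightarrow> real" where
  "mixing_density r s p =
     (r - 1) / (real_zeta s * Gamma s * (1 - p) powr r) *
     (LINT w:{p<..<1}|lborel.
        (w - p) powr (r - 2) * (- ln w) powr (s - 1) / w powr (r - 1))"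

text \<open>Measurability of \<open>f\<close> on \<open>A\<close> is part of \<^const>\<open>set_integrable\<close>; values outside \<open>A\<close> are
  irrelevant.\<close>

definition prob_density_on :: "real set \<Rightarrow> (real \<Rightarrow> real) \<Rightarrow> bool" where
  "prob_density_on A f \<longleftrightarrow>
     (\<forall>x\<in>A. 0 \<le> f x) \<and> set_integrable lborel A f \<and> (LINT x:A|lborel. f x) = 1"

end

theory Submission
  imports Defs
begin

text \<open>
  The Zeta distribution is a mixture of geometric distributions: the substitution
  \<open>w = exp (- t / (x + 1))\<close> in Euler's integral for \<open>Gamma s\<close> gives
  \<open>(x + 1) powr (- s) = (1 / Gamma s) * (integral over 0 < w < 1 of w ^ x * (- ln w) powr (s - 1))\<close>
  (\<open>nn_integral_power_log\<close>). For \<open>r > 1\<close> the monomial \<open>w ^ x\<close> is in turn a Beta integral: up to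
  the factor \<open>Beta (x + 1) (r - 1)\<close>, it is \<open>w powr (1 - r)\<close> times the integral of
  \<open>p ^ x * (w - p) powr (r - 2)\<close> over \<open>0 < p < w\<close> (\<open>nn_integral_scaled_Beta\<close>).
  Substituting the second formula into the first and exchanging the order of integration over the
  triangle \<open>0 < p < w < 1\<close> leaves \<open>p ^ x\<close> integrated against exactly the inner integral that
  occurs in the mixing density (\<open>nn_integral_power_mixing_kernel\<close>). The factor
  \<open>(1 - p) powr r\<close> of the Negative Binomial mass cancels the one in the denominator of the density,
  and the Gamma factors collapse because \<open>Gamma r = (r - 1) * Gamma (r - 1)\<close>. All integrands are
  nonnegative, so Tonelli's theorem delivers convergence together with the values.

  The density has total mass one for a probabilistic reason: for fixed \<open>p\<close> the Negative Binomial
  masses sum to one (Newton's binomial series), so the mass of the density is the sum over \<open>x\<close> of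
  the mixture integrals, that is, of the Zeta masses.

  For uniqueness, divide the mixture equations by their constant factors: they prescribe all moments
  of the finite measure \<open>(1 - p) powr r * \<mu>(dp)\<close>. A measure on \<open>(0, 1)\<close> is determined by its
  moments, because its characteristic function is the sum of the moment series
  (\<open>real_distribution_eqI_moments\<close>), and the strictly positive weight \<open>(1 - p) powr r\<close> can be
  divided out again (\<open>unit_interval_measure_eqI_weighted_moments\<close>).
\<close>

section \<open>Measures on the unit interval and their moments\<close>

text \<open>
  On \<open>[- 1, 1]\<close> all absolute moments are at most one, so the Taylor remainder of the characteristic
  function at \<open>t\<close> is at most \<open>2 * \<bar>t\<bar> ^ n / n!\<close> and the moments determine that function everywhere.
\<close>

lemma real_distribution_eqI_moments:
  fixes M N :: "real measure"
  assumes "real_distribution M" "real_distribution N"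
    and M1: "AE x in M. \<bar>x\<bar> \<le> 1" and N1: "AE x in N. \<bar>x\<bar> \<le> 1"
    and moments: "\<And>k. (LINT x|M. x ^ k) = (LINT x|N. x ^ k)"
  shows "M = N"
proof (rule Levy_uniqueness)
  show "real_distribution M" "real_distribution N" by fact+
  define S where "S X t n = (\<Sum>k\<le>n. ((\<i> * complex_of_real t) ^ k / fact k) *
      complex_of_real (LINT x|X. x ^ k))" for X :: "real measure" and t n
  have lim: "(\<lambda>n. S X t n) \<longlonglongrightarrow> char X t"
    if X: "real_distribution X" and X1: "AE x in X. \<bar>x\<bar> \<le> 1" for X t
  proof -
    interpret X: real_distribution X by (rule X)
    have pow1: "AE x in X. \<bar>x\<bar> ^ k \<le> 1" for k
      using X1 by eventually_elim (simp add: power_le_one)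
    have int: "integrable X (\<lambda>x. x ^ k)" for k
      by (rule X.integrable_const_bound[where B = 1]) (use pow1 in \<open>auto simp: power_abs\<close>)
    have abs_moment: "(LINT x|X. \<bar>x\<bar> ^ k) \<le> 1" for k
    proof -
      have "(LINT x|X. \<bar>x\<bar> ^ k) \<le> (LINT x|X. 1)"
        using int[of k] pow1[of k]
        by (intro integral_mono_AE) (auto simp flip: power_abs)
      then show ?thesis using X.prob_space by simp
    qed
    have bound: "norm (S X t n - char X t) \<le> 2 * (inverse (fact n) * \<bar>t\<bar> ^ n)" for n
    proof -
      have "norm (S X t n - char X t) \<le> (2 * \<bar>t\<bar> ^ n / fact n) * (LINT x|X. \<bar>x\<bar> ^ n)"
        unfolding S_def by (subst norm_minus_commute) (rule X.char_approx1[OF int])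
      also have "\<dots> \<le> (2 * \<bar>t\<bar> ^ n / fact n) * 1"
        by (intro mult_left_mono abs_moment) simp
      finally show ?thesis by (simp add: field_simps)
    qed
    have "(\<lambda>n. 2 * (inverse (fact n) * \<bar>t\<bar> ^ n)) \<longlonglongrightarrow> 2 * 0"
      by (intro tendsto_mult_left summable_LIMSEQ_zero[OF summable_exp])
    hence "(\<lambda>n. 2 * (inverse (fact n) * \<bar>t\<bar> ^ n)) \<longlonglongrightarrow> 0" by simp
    hence "(\<lambda>n. S X t n - char X t) \<longlonglongrightarrow> 0"
      by (rule Lim_null_comparison[rotated]) (use bound in auto)
    then show ?thesis by (rule LIM_zero_cancel)
  qed
  have "S M = S N" by (intro ext) (simp add: S_def moments)
  then show "char M = char N"
    using lim[OF assms(1) M1] lim[OF assms(2) N1] by (intro ext) (metis LIMSEQ_unique)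
qed

text \<open>
  Reweighting by \<open>h\<close> and normalising by \<open>c\<close>, the zeroth weighted moment, which both measures
  share, turns each of them into a distribution whose moments are the weighted moments divided by
  \<open>c\<close>. Since \<open>h\<close> is strictly positive, the original measure is recovered by integrating \<open>c / h\<close>.
\<close>

lemma unit_interval_measure_eqI_weighted_moments:
  fixes M N :: "real measure" and h :: "real \<Rightarrow> real"
  assumes "prob_space M" "prob_space N"
    and setsM: "sets M = sets (restrict_space borel {0<..<1})"
    and setsN: "sets N = sets (restrict_space borel {0<..<1})"
    and h_meas [measurable]: "h \<in> borel_measurable borel"
    and h_pos: "\<And>p. 0 < p \<Longrightarrow> p < 1 \<Longrightarrow> 0 < h p"
    and h_le: "\<And>p. 0 < p \<Longrightarrow> p < 1 \<Longrightarrow> h p \<le> 1"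
    and moments: "\<And>n. (LINT p|M. p ^ n * h p) = (LINT p|N. p ^ n * h p)"
  shows "M = N"
proof -
  define c where "c = (LINT p|M. h p)"
  \<comment> \<open>the push-forward enlarges the \<open>\<sigma>\<close>-algebra from the Borel sets of the interval to those of the line\<close>
  define D where "D X = distr (density X (\<lambda>p. ennreal (h p / c))) borel (\<lambda>p. p)" for X :: "real measure"
  have space: "space X = {0<..<1}" if "sets X = sets (restrict_space borel {0<..<1})"
    for X :: "real measure"
    using sets_eq_imp_space_eq[OF that] by (simp add: space_restrict_space)
  have meas: "f \<in> borel_measurable X"
    if "f \<in> borel_measurable borel" "sets X = sets (restrict_space borel {0<..<1})"
    for f :: "real \<Rightarrow> real" and X
    unfolding measurable_cong_sets[OF that(2) refl] by (rule measurable_restrict_space1[OF that(1)])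
  have int: "integrable X h"
    if "prob_space X" and setsX: "sets X = sets (restrict_space borel {0<..<1})"
    for X :: "real measure"
  proof -
    interpret X: prob_space X by fact
    have "AE p in X. norm (h p) \<le> 1"
    proof (rule AE_I2)
      fix p assume "p \<in> space X"
      hence "0 < p" "p < 1" using space[OF setsX] by auto
      then show "norm (h p) \<le> 1" using h_pos[of p] h_le[of p] by simp
    qed
    then show ?thesis by (rule X.integrable_const_bound[OF _ meas[OF h_meas setsX]])
  qed
  have c_pos: "c > 0"
  proof -
    interpret M: prob_space M by fact
    have nn: "AE p in M. 0 \<le> h p"
      using h_pos space[OF setsM] by (intro AE_I2) (auto intro: less_imp_le)
    have "c \<noteq> 0"
    proof
      assume "c = 0"
      hence "AE p in M. h p = 0"
        using integral_nonneg_eq_0_iff_AE[OF int[OF assms(1) setsM] nn] by (simp add: c_def)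
      moreover have "AE p in M. h p \<noteq> 0"
        using h_pos[THEN less_imp_neq] space[OF setsM] by (intro AE_I2) fastforce
      ultimately have "AE p in M. False" by eventually_elim simp
      then show False by (simp add: M.AE_False)
    qed
    moreover have "c \<ge> 0" unfolding c_def using nn by (rule integral_nonneg_AE)
    ultimately show ?thesis by simp
  qed
  have D: "real_distribution (D X)" "AE x in D X. \<bar>x\<bar> \<le> 1"
     "(LINT x|D X. x ^ n) = (LINT p|X. p ^ n * h p) / c"
     "A \<in> sets X \<Longrightarrow> emeasure X A = (\<integral>\<^sup>+p. ennreal (c / h p) * indicator A p \<partial>D X)"
    if X: "prob_space X" and setsX: "sets X = sets (restrict_space borel {0<..<1})"
      and cX: "c = (LINT p|X. h p)" for X n A
  proof -
    interpret X: prob_space X by fact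
    note spX = space[OF setsX]
    have [measurable]: "f \<in> borel_measurable X" if "f \<in> borel_measurable borel" for f :: "real \<Rightarrow> real"
      using meas[OF that setsX] .
    have hc_nn: "AE p in X. 0 \<le> h p / c"
      using h_pos c_pos spX by (intro AE_I2) (auto intro!: divide_nonneg_pos less_imp_le)
    have "emeasure (density X (\<lambda>p. ennreal (h p / c))) (space X) = (\<integral>\<^sup>+p. ennreal (h p / c) \<partial>X)"
      by (subst emeasure_density) (auto intro!: nn_integral_cong)
    also have "\<dots> = ennreal (LINT p|X. h p / c)"
      using int[OF X setsX] hc_nn by (intro nn_integral_eq_integral) auto
    also have "\<dots> = 1" using c_pos cX by simp
    finally have "prob_space (density X (\<lambda>p. ennreal (h p / c)))"
      by (intro prob_spaceI) simp
    hence "prob_space (D X)"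
      unfolding D_def by (rule prob_space.prob_space_distr) simp
    then show "real_distribution (D X)"
      by (simp add: real_distribution_def real_distribution_axioms_def D_def)
    show "AE x in D X. \<bar>x\<bar> \<le> 1"
      unfolding D_def
      by (subst AE_distr_iff) (auto simp: spX AE_density intro!: AE_I2)
    have "(LINT x|D X. x ^ n) = (LINT p|density X (\<lambda>p. ennreal (h p / c)). p ^ n)"
      unfolding D_def by (subst integral_distr) auto
    also have "\<dots> = (LINT p|X. (h p / c) *\<^sub>R p ^ n)"
      using hc_nn by (intro integral_density) auto
    also have "\<dots> = (LINT p|X. (p ^ n * h p) / c)"
      by (intro Bochner_Integration.integral_cong) auto
    also have "\<dots> = (LINT p|X. p ^ n * h p) / c" by simp
    finally show "(LINT x|D X. x ^ n) = (LINT p|X. p ^ n * h p) / c" .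
    show "emeasure X A = (\<integral>\<^sup>+p. ennreal (c / h p) * indicator A p \<partial>D X)" if A: "A \<in> sets X"
    proof -
      have [measurable]: "A \<in> sets borel"
        using A setsX by (auto simp: sets_restrict_space)
      have "(\<integral>\<^sup>+p. ennreal (c / h p) * indicator A p \<partial>D X)
          = (\<integral>\<^sup>+p. ennreal (c / h p) * indicator A p \<partial>density X (\<lambda>p. ennreal (h p / c)))"
        unfolding D_def by (subst nn_integral_distr) auto
      also have "\<dots> = (\<integral>\<^sup>+p. ennreal (h p / c) * (ennreal (c / h p) * indicator A p) \<partial>X)"
        using A by (subst nn_integral_density) auto
      also have "\<dots> = (\<integral>\<^sup>+p. indicator A p \<partial>X)"
      proof (intro nn_integral_cong)
        fix p assume "p \<in> space X"
        hence "h p > 0" using h_pos spX by auto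
        then show "ennreal (h p / c) * (ennreal (c / h p) * indicator A p) = indicator A p"
          using c_pos by (simp add: indicator_def ennreal_mult'[symmetric])
      qed
      also have "\<dots> = emeasure X A" using A by simp
      finally show ?thesis by simp
    qed
  qed
  have cN: "c = (LINT p|N. h p)" using moments[of 0] by (simp add: c_def)
  note DM = D[OF assms(1) setsM c_def] and DN = D[OF assms(2) setsN cN]
  have "D M = D N"
    by (rule real_distribution_eqI_moments) (use DM DN moments in auto)
  then show ?thesis
    using DM(4) DN(4) setsM setsN by (intro measure_eqI) auto
qed

section \<open>Negative Binomial and Zeta masses sum to one\<close>

text \<open>
  Newton's series for \<open>(1 - p) powr (- r)\<close>: the signs of the generalised binomial coefficients
  of \<open>- r\<close> and of the powers of \<open>- p\<close> cancel, which leaves \<open>pochhammer r n / n!\<close>.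
\<close>

lemma neg_binomial_mass_sums:
  assumes r: "0 < r" and p: "0 < p" "p < 1"
  shows "neg_binomial_mass r p sums 1"
proof -
  have "(\<lambda>n. ((- r) gchoose n) * (- p) ^ n) sums (1 + - p) powr (- r)"
    using p by (intro gen_binomial_real) auto
  hence "(\<lambda>n. ((- r) gchoose n) * (- p) ^ n * (1 - p) powr r) sums
      ((1 + - p) powr (- r) * (1 - p) powr r)"
    by (rule sums_mult2)
  also have "(1 + - p) powr (- r) * (1 - p) powr r = 1"
    using p by (simp flip: powr_add)
  also have "(\<lambda>n. ((- r) gchoose n) * (- p) ^ n * (1 - p) powr r) = neg_binomial_mass r p"
  proof
    fix n :: nat
    have "r \<notin> \<int>\<^sub>\<le>\<^sub>0" using r by (auto elim!: nonpos_Ints_cases)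
    hence "pochhammer r n = Gamma (r + real n) / Gamma r"
      by (rule pochhammer_Gamma)
    moreover have "(- 1) ^ n * (- p) ^ n = p ^ n"
      by (simp flip: power_mult_distrib)
    moreover have "Gamma (real n + 1) = fact n"
      using Gamma_fact[of n, where 'a = real] by (simp add: add.commute)
    ultimately show "((- r) gchoose n) * (- p) ^ n * (1 - p) powr r = neg_binomial_mass r p n"
      by (simp add: gbinomial_pochhammer neg_binomial_mass_def mult_ac)
  qed
  finally show ?thesis .
qed

lemma zeta_mass_sums:
  assumes s: "1 < s"
  shows "0 < real_zeta s" "zeta_mass s sums 1"
proof -
  have "summable (\<lambda>n. real n powr (- s))"
    using s by (subst summable_real_powr_iff) auto
  hence "summable (\<lambda>n. real (Suc n) powr (- s))"
    by (subst summable_Suc_iff)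
  hence sm: "summable (\<lambda>n. (real n + 1) powr (- s))" by (simp add: add.commute)
  show pos: "0 < real_zeta s"
    unfolding real_zeta_def by (rule suminf_pos[OF sm]) (simp add: powr_gt_zero)
  have "(\<lambda>n. (real n + 1) powr (- s)) sums real_zeta s"
    unfolding real_zeta_def using sm by (rule summable_sums)
  from sums_divide[OF this, of "real_zeta s"] pos show "zeta_mass s sums 1"
    by (simp add: zeta_mass_def[abs_def])
qed

section \<open>The inner integral of the mixing density\<close>

definition mixing_kernel :: "real \<Rightarrow> real \<Rightarrow> real \<Rightarrow> real \<Rightarrow> real" where
  "mixing_kernel r s p w = (w - p) powr (r - 2) * (- ln w) powr (s - 1) / w powr (r - 1)"

text \<open>
  The singularity at \<open>w = p\<close> is that of a Beta integrand with second parameter one, shifted by \<open>p\<close>;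
  the shifted domain \<open>[p, p + 1]\<close> contains \<open>(p, 1)\<close>.
\<close>

lemma truncated_powr_integrable:
  fixes a p :: real
  assumes "0 < a" "0 \<le> p"
  shows "set_integrable lborel {p<..<1} (\<lambda>w. (w - p) powr (a - 1))"
proof -
  have "set_integrable lborel {0..1} (\<lambda>t::real. t powr (a - 1) * (1 - t) powr (1 - 1))"
    by (rule integrable_Beta) (use assms in auto)
  hence "integrable lborel (\<lambda>t::real. indicator {0..1} t *\<^sub>R (t powr (a - 1) * (1 - t) powr (1 - 1)))"
    by (simp add: set_integrable_def)
  from lborel_integrable_real_affine[OF this, of 1 "- p"]
  have "integrable lborel (\<lambda>w::real. indicator {0..1} (-p + 1 * w) *\<^sub>R
      ((-p + 1 * w) powr (a - 1) * (1 - (-p + 1 * w)) powr (1 - 1)))"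
    by simp
  then show ?thesis
    unfolding set_integrable_def
    by (rule Bochner_Integration.integrable_bound) (use assms in \<open>auto simp: indicator_def\<close>)
qed

text \<open>
  Away from \<open>w = p\<close> the kernel is harmless: both \<open>- ln w\<close> and \<open>1 / w\<close> decrease in \<open>w\<close>, so these
  factors are bounded by their values at \<open>p\<close>.
\<close>

lemma mixing_kernel_integrable:
  assumes r: "1 < r" and s: "1 < s" and p: "0 < p"
  shows "set_integrable lborel {p<..<1} (mixing_kernel r s p)"
proof -
  have "set_integrable lborel {p<..<1} (\<lambda>w. (w - p) powr (r - 1 - 1))"
    by (rule truncated_powr_integrable) (use r p in auto)
  hence "set_integrable lborel {p<..<1}
      (\<lambda>w. ((- ln p) powr (s - 1) / p powr (r - 1)) * (w - p) powr (r - 1 - 1))"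
    by (rule set_integrable_mult_right[rotated])
  then show ?thesis
    unfolding set_integrable_def
  proof (rule Bochner_Integration.integrable_bound)
    show "AE w in lborel. norm (indicator {p<..<1} w *\<^sub>R mixing_kernel r s p w) \<le>
        norm (indicator {p<..<1} w *\<^sub>R
          (((- ln p) powr (s - 1) / p powr (r - 1)) * (w - p) powr (r - 1 - 1)))"
    proof (intro always_eventually allI)
      fix w :: real
      show "norm (indicator {p<..<1} w *\<^sub>R mixing_kernel r s p w) \<le>
        norm (indicator {p<..<1} w *\<^sub>R
          (((- ln p) powr (s - 1) / p powr (r - 1)) * (w - p) powr (r - 1 - 1)))"
      proof (cases "p < w \<and> w < 1")
        case True
        have "(- ln w) powr (s - 1) / w powr (r - 1) \<le> (- ln p) powr (s - 1) / p powr (r - 1)"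
          using True p r s by (intro frac_le powr_mono2) auto
        hence "(w - p) powr (r - 2) * ((- ln w) powr (s - 1) / w powr (r - 1)) \<le>
            (w - p) powr (r - 2) * ((- ln p) powr (s - 1) / p powr (r - 1))"
          by (rule mult_left_mono) simp
        then show ?thesis using True by (simp add: mixing_kernel_def mult_ac)
      qed auto
    qed
  qed (simp add: mixing_kernel_def)
qed

text \<open>
  Euler's Beta integral after the substitution \<open>p = w * t\<close>: it reproduces the power of \<open>w\<close> up to a
  constant. The nonnegative integral is the form needed for Tonelli's theorem.
\<close>

lemma nn_integral_scaled_Beta:
  fixes w b :: real
  assumes w: "0 < w" and b: "0 < b"
  shows "(\<integral>\<^sup>+p. ennreal (p ^ n * (w - p) powr (b - 1)) * indicator {0<..<w} p \<partial>lborel)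
       = ennreal (w powr (real n + b) * Beta (real n + 1) b)"
proof -
  have "((\<lambda>t. t powr (real n + 1 - 1) * (1 - t) powr (b - 1)) has_integral Beta (real n + 1) b) {0<..<1}"
    using has_integral_Beta_real[of "real n + 1" b] b by (simp add: has_integral_Icc_iff_Ioo)
  from nn_integral_has_integral_lebesgue'[OF _ this]
  have Beta: "(\<integral>\<^sup>+t. ennreal (t powr real n * (1 - t) powr (b - 1)) * indicator {0<..<1} t \<partial>lborel)
      = ennreal (Beta (real n + 1) b)" by simp
  have "(\<integral>\<^sup>+p. ennreal (p ^ n * (w - p) powr (b - 1)) * indicator {0<..<w} p \<partial>lborel)
     = ennreal w * (\<integral>\<^sup>+t. ennreal ((w * t) ^ n * (w - w * t) powr (b - 1)) * indicator {0<..<w} (w * t) \<partial>lborel)"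
    using w by (subst nn_integral_real_affine[where c=w and t=0]) auto
  also have "\<dots> = ennreal w * (\<integral>\<^sup>+t. ennreal (w powr (real n + b - 1)) *
      (ennreal (t powr real n * (1 - t) powr (b - 1)) * indicator {0<..<1} t) \<partial>lborel)"
  proof (intro arg_cong[where f="\<lambda>x. ennreal w * x"] nn_integral_cong)
    fix t :: real
    show "ennreal ((w * t) ^ n * (w - w * t) powr (b - 1)) * indicator {0<..<w} (w * t) =
      ennreal (w powr (real n + b - 1)) *
      (ennreal (t powr real n * (1 - t) powr (b - 1)) * indicator {0<..<1} t)"
    proof (cases "0 < t \<and> t < 1")
      case True
      have "w - w * t = w * (1 - t)" by (simp add: algebra_simps)
      hence "(w * t) ^ n * (w - w * t) powr (b - 1)
          = w powr (real n + b - 1) * (t powr real n * (1 - t) powr (b - 1))"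
        using True w
        by (simp add: powr_mult powr_realpow power_mult_distrib powr_add[symmetric]
            flip: powr_realpow) (simp add: powr_add powr_diff)
      then show ?thesis using True w by (simp add: ennreal_mult)
    next
      case False
      hence "\<not> (0 < w * t \<and> w * t < w)" using w
        by (simp add: zero_less_mult_iff)
      then show ?thesis using False by (auto simp: indicator_def)
    qed
  qed
  also have "\<dots> = ennreal w * (ennreal (w powr (real n + b - 1)) * ennreal (Beta (real n + 1) b))"
    by (subst nn_integral_cmult) (auto simp: Beta)
  also have "\<dots> = ennreal (w powr (real n + b) * Beta (real n + 1) b)"
    using w b by (simp add: ennreal_mult'[symmetric] powr_diff Beta_def Gamma_real_nonneg)
  finally show ?thesis .
qed

text \<open>
  The representation of \<open>(n + 1) powr (- s)\<close> as a moment over the unit interval. The scale \<open>c = n + 1\<close> in the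
  substitution \<open>w = exp (- t / c)\<close> is chosen so that \<open>w ^ n\<close> and the Jacobian \<open>w / c\<close> together
  contribute \<open>exp (- t) / c\<close>, which makes the integrand a multiple of that of \<open>Gamma s\<close>.
\<close>

lemma nn_integral_power_log:
  fixes s :: real
  assumes s: "0 < s"
  shows "(\<integral>\<^sup>+w. ennreal (w ^ n * (- ln w) powr (s - 1)) * indicator {0<..<1} w \<partial>lborel)
       = ennreal (Gamma s * (real n + 1) powr (- s))"
proof -
  define c where "c = real n + 1"
  have c: "c > 0" by (simp add: c_def)
  define g where "g = (\<lambda>t::real. exp (- t / c))"
  define f where "f = (\<lambda>w::real. w ^ n * (- ln w) powr (s - 1))"
  have img: "g ` {0<..} = {0<..<1}"
  proof (intro equalityI subsetI)
    fix w :: real assume w: "w \<in> {0<..<1}"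
    have "w = g (- (c * ln w))" using w c by (simp add: g_def)
    moreover have "- (c * ln w) > 0" using w c by (simp add: mult_pos_neg)
    ultimately show "w \<in> g ` {0<..}" by blast
  qed (use c in \<open>auto simp: g_def\<close>)
  have der: "(g has_field_derivative (- exp (- t / c) / c)) (at t within {0<..})" for t
    unfolding g_def using c by (auto intro!: derivative_eq_intros)
  have inj: "inj_on g {0<..}" using c by (auto simp: inj_on_def g_def)
  have integrand: "\<bar>- exp (- t / c) / c\<bar> * f (g t) = c powr (- s) * (t powr (s - 1) / exp t)"
    if "t \<in> {0<..}" for t
  proof -
    have "exp (- t / c) * exp (- t / c) ^ n = exp (-t)"
    proof -
      have "exp (- t / c) * exp (- t / c) ^ n = exp (- t / c) ^ Suc n" by simp
      also have "\<dots> = exp (real (Suc n) * (- t / c))" by (rule exp_of_nat_mult[symmetric])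
      also have "real (Suc n) * (- t / c) = - t" using c by (simp add: c_def field_simps)
      finally show ?thesis .
    qed
    moreover have "\<bar>- exp (- t / c) / c\<bar> * f (g t)
        = (exp (- t / c) * exp (- t / c) ^ n) * ((t / c) powr (s - 1) / c)"
      using c by (simp add: f_def g_def)
    ultimately show ?thesis using c that
      by (simp add: powr_divide powr_diff powr_minus exp_minus field_simps)
  qed
  have "((\<lambda>t. t powr (s - 1) / exp t) has_integral Gamma s) {0<..}"
    using Gamma_integral_real[OF s]
    by (subst (asm) has_integral_spike_set_eq[where T = "{0<..}"])
       (auto intro: negligible_subset[OF negligible_sing[of "0::real"]])
  from has_integral_mult_right[OF this, of "c powr (- s)"]
  have "((\<lambda>t. \<bar>- exp (- t / c) / c\<bar> * f (g t)) has_integral c powr (- s) * Gamma s) {0<..}"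
    by (rule has_integral_eq[rotated]) (rule integrand[symmetric])
  hence "(\<lambda>t. \<bar>- exp (- t / c) / c\<bar> * f (g t)) absolutely_integrable_on {0<..} \<and>
      integral {0<..} (\<lambda>t. \<bar>- exp (- t / c) / c\<bar> * f (g t)) = c powr (- s) * Gamma s"
    by (intro conjI nonnegative_absolutely_integrable_1 integral_unique has_integral_integrable)
       (auto simp: f_def g_def)
  hence "f absolutely_integrable_on {0<..<1} \<and> integral {0<..<1} f = c powr (- s) * Gamma s"
    by (subst (asm) has_absolute_integral_change_of_variables_1'[OF _ der inj]) (auto simp: img)
  hence "(f has_integral c powr (- s) * Gamma s) {0<..<1}"
    by (metis has_integral_integral set_lebesgue_integral_eq_integral(1))
  from nn_integral_has_integral_lebesgue'[OF _ this]
  show ?thesis by (simp add: f_def c_def mult.commute)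
qed


text \<open>
  Tonelli on the triangle \<open>0 < p < w < 1\<close>: integrating over \<open>p\<close> first gives a Beta integral that
  contributes \<open>w powr (n + r - 1)\<close>; the denominator \<open>w powr (r - 1)\<close> of the kernel reduces this to
  \<open>w ^ n\<close>, so that the logarithmic integral remains.
\<close>

lemma nn_integral_power_mixing_kernel:
  assumes r: "1 < r" and s: "1 < s"
  shows "(\<integral>\<^sup>+p. ennreal (p ^ n * (LINT w:{p<..<1}|lborel. mixing_kernel r s p w)) *
            indicator {0<..<1} p \<partial>lborel)
       = ennreal (Beta (real n + 1) (r - 1) * (Gamma s * (real n + 1) powr (- s)))"
proof -
  define K where "K = (\<lambda>w::real. (- ln w) powr (s - 1) / w powr (r - 1))"
  \<comment> \<open>the indicator of the triangle, in a form whose joint measurability in \<open>p\<close> and \<open>w\<close> is automatic\<close>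
  define F where "F = (\<lambda>p w::real. ennreal (p ^ n * mixing_kernel r s p w) *
      (indicator {0<..} p * indicator {..<1} w * (if p < w then 1 else 0)))"
  have meas [measurable]: "case_prod F \<in> borel_measurable (lborel \<Otimes>\<^sub>M lborel)"
    unfolding F_def mixing_kernel_def by measurable
  have "(\<integral>\<^sup>+p. ennreal (p ^ n * (LINT w:{p<..<1}|lborel. mixing_kernel r s p w)) *
            indicator {0<..<1} p \<partial>lborel) = (\<integral>\<^sup>+p. (\<integral>\<^sup>+w. F p w \<partial>lborel) \<partial>lborel)"
  proof (intro nn_integral_cong)
    fix p :: real
    show "ennreal (p ^ n * (LINT w:{p<..<1}|lborel. mixing_kernel r s p w)) * indicator {0<..<1} p
       = (\<integral>\<^sup>+w. F p w \<partial>lborel)"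
    proof (cases "0 < p \<and> p < 1")
      case True
      have "integrable lborel (\<lambda>w. indicator {p<..<1} w *\<^sub>R mixing_kernel r s p w)"
        using mixing_kernel_integrable[OF r s, of p] True by (simp add: set_integrable_def)
      hence "ennreal (LINT w:{p<..<1}|lborel. mixing_kernel r s p w)
          = (\<integral>\<^sup>+w. ennreal (indicator {p<..<1} w *\<^sub>R mixing_kernel r s p w) \<partial>lborel)"
        unfolding set_lebesgue_integral_def
        by (intro nn_integral_eq_integral[symmetric])
           (auto simp: mixing_kernel_def indicator_def)
      hence "ennreal (p ^ n * (LINT w:{p<..<1}|lborel. mixing_kernel r s p w))
          = ennreal (p ^ n) *
              (\<integral>\<^sup>+w. ennreal (indicator {p<..<1} w *\<^sub>R mixing_kernel r s p w) \<partial>lborel)"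
        using True by (simp add: ennreal_mult')
      also have "\<dots> = (\<integral>\<^sup>+w. ennreal (p ^ n) *
              ennreal (indicator {p<..<1} w *\<^sub>R mixing_kernel r s p w) \<partial>lborel)"
        by (rule nn_integral_cmult[symmetric]) (simp add: mixing_kernel_def)
      also have "\<dots> = (\<integral>\<^sup>+w. F p w \<partial>lborel)"
        using True by (intro nn_integral_cong) (auto simp: F_def indicator_def ennreal_mult')
      finally show ?thesis using True by simp
    next
      case False
      hence "F p w = 0" for w by (auto simp: F_def indicator_def)
      then show ?thesis using False by (auto simp: indicator_def)
    qed
  qed
  also have "\<dots> = (\<integral>\<^sup>+w. (\<integral>\<^sup>+p. F p w \<partial>lborel) \<partial>lborel)"
    by (rule lborel_pair.Fubini'[OF meas, symmetric])
  also have "\<dots> = (\<integral>\<^sup>+w. ennreal (Beta (real n + 1) (r - 1)) *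
      (ennreal (w ^ n * (- ln w) powr (s - 1)) * indicator {0<..<1} w) \<partial>lborel)"
  proof (intro nn_integral_cong)
    fix w :: real
    show "(\<integral>\<^sup>+p. F p w \<partial>lborel) = ennreal (Beta (real n + 1) (r - 1)) *
      (ennreal (w ^ n * (- ln w) powr (s - 1)) * indicator {0<..<1} w)"
    proof (cases "0 < w \<and> w < 1")
      case True
      have "(\<integral>\<^sup>+p. F p w \<partial>lborel) = (\<integral>\<^sup>+p. ennreal (K w) *
          (ennreal (p ^ n * (w - p) powr (r - 1 - 1)) * indicator {0<..<w} p) \<partial>lborel)"
      proof (intro nn_integral_cong)
        fix p :: real
        have "p ^ n * mixing_kernel r s p w = K w * (p ^ n * (w - p) powr (r - 1 - 1))"
          by (simp add: mixing_kernel_def K_def)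
        moreover have "K w \<ge> 0" by (simp add: K_def)
        ultimately show "F p w = ennreal (K w) *
            (ennreal (p ^ n * (w - p) powr (r - 1 - 1)) * indicator {0<..<w} p)"
          using True by (auto simp: F_def indicator_def ennreal_mult' mult_ac)
      qed
      also have "\<dots> = ennreal (K w) * (\<integral>\<^sup>+p. ennreal (p ^ n * (w - p) powr (r - 1 - 1)) *
          indicator {0<..<w} p \<partial>lborel)"
        by (rule nn_integral_cmult) simp
      also have "\<dots> = ennreal (K w) * ennreal (w powr (real n + (r - 1)) * Beta (real n + 1) (r - 1))"
        using True r by (subst nn_integral_scaled_Beta) auto
      also have "\<dots> = ennreal (K w * (w powr (real n + (r - 1)) * Beta (real n + 1) (r - 1)))"
        by (rule ennreal_mult'[symmetric]) (simp add: K_def)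
      also have "K w * (w powr (real n + (r - 1)) * Beta (real n + 1) (r - 1))
          = Beta (real n + 1) (r - 1) * (w ^ n * (- ln w) powr (s - 1))"
        using True by (simp add: K_def powr_add powr_realpow)
      finally have "(\<integral>\<^sup>+p. F p w \<partial>lborel)
          = ennreal (Beta (real n + 1) (r - 1) * (w ^ n * (- ln w) powr (s - 1)))" .
      moreover have "0 \<le> Beta (real n + 1) (r - 1)"
        using r by (simp add: Beta_def)
      ultimately show ?thesis using True by (simp only: ennreal_mult') simp
    next
      case False
      hence "F p w = 0" for p by (auto simp: F_def indicator_def)
      then show ?thesis using False by (auto simp: indicator_def)
    qed
  qed
  also have "\<dots> = ennreal (Beta (real n + 1) (r - 1)) * ennreal (Gamma s * (real n + 1) powr (- s))"
    using s by (subst nn_integral_cmult) (auto simp: nn_integral_power_log)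
  also have "\<dots> = ennreal (Beta (real n + 1) (r - 1) * (Gamma s * (real n + 1) powr (- s)))"
    using r by (intro ennreal_mult'[symmetric]) (simp add: Beta_def Gamma_real_nonneg)
  finally show ?thesis .
qed

section \<open>The mixture integrals\<close>

lemma mixing_density_kernel:
  "mixing_density r s p = (r - 1) / (real_zeta s * Gamma s * (1 - p) powr r) *
     (LINT w:{p<..<1}|lborel. mixing_kernel r s p w)"
  by (simp add: mixing_density_def mixing_kernel_def)

lemma mixing_kernel_integral_measurable [measurable]:
  "(\<lambda>p. LINT w:{p<..<1}|lborel. mixing_kernel r s p w) \<in> borel_measurable borel"
proof -
  have "(\<lambda>(p, w). (if p < w \<and> w < 1 then 1 else 0) *\<^sub>R mixing_kernel r s p w)
      \<in> borel_measurable (borel \<Otimes>\<^sub>M lborel)"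
    unfolding mixing_kernel_def by measurable
  hence "(\<lambda>p. LINT w|lborel. (if p < w \<and> w < 1 then 1 else 0) *\<^sub>R mixing_kernel r s p w)
      \<in> borel_measurable borel"
    by (intro lborel.borel_measurable_lebesgue_integral)
  also have "(\<lambda>p. LINT w|lborel. (if p < w \<and> w < 1 then 1 else 0) *\<^sub>R mixing_kernel r s p w)
     = (\<lambda>p. LINT w:{p<..<1}|lborel. mixing_kernel r s p w)"
    unfolding set_lebesgue_integral_def
    by (intro ext Bochner_Integration.integral_cong) (auto simp: indicator_def)
  finally show ?thesis .
qed

lemma mixing_density_measurable [measurable]:
  "mixing_density r s \<in> borel_measurable borel"
  unfolding mixing_density_kernel[abs_def] by measurable

lemma mixing_density_nonneg:
  assumes "1 < r" "1 < s"
  shows "0 \<le> mixing_density r s p"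
proof -
  have "0 \<le> (LINT w:{p<..<1}|lborel. mixing_kernel r s p w)"
    unfolding set_lebesgue_integral_def
    by (intro integral_nonneg_AE AE_I2) (simp add: mixing_kernel_def)
  then show ?thesis
    unfolding mixing_density_kernel using assms zeta_mass_sums(1)[of s]
    by (intro mult_nonneg_nonneg divide_nonneg_nonneg) (auto simp: Gamma_real_nonneg)
qed

lemma neg_binomial_mass_measurable [measurable]:
  "(\<lambda>p. neg_binomial_mass r p x) \<in> borel_measurable borel"
  unfolding neg_binomial_mass_def by measurable

lemma neg_binomial_mass_nonneg:
  assumes "0 < r" "0 \<le> p"
  shows "0 \<le> neg_binomial_mass r p x"
  using assms unfolding neg_binomial_mass_def
  by (intro mult_nonneg_nonneg divide_nonneg_nonneg) (auto simp: Gamma_real_nonneg)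

text \<open>
  The powers of \<open>1 - p\<close> cancel, so the integrand is a constant \<open>A\<close> times \<open>p ^ x\<close> times the kernel
  integral; \<open>A\<close> is the reciprocal of \<open>Beta (x + 1) (r - 1) * real_zeta s * Gamma s\<close>.
\<close>

lemma nn_integral_neg_binomial_mixture:
  assumes r: "1 < r" and s: "1 < s"
  shows "(\<integral>\<^sup>+p. ennreal (neg_binomial_mass r p x * mixing_density r s p) *
      indicator {0<..<1} p \<partial>lborel) = ennreal (zeta_mass s x)"
proof -
  define A where "A = Gamma (r + real x) / (Gamma r * Gamma (real x + 1)) *
      ((r - 1) / (real_zeta s * Gamma s))"
  have z: "real_zeta s > 0" using zeta_mass_sums[OF s] by simp
  have A: "A \<ge> 0" using r s z
    by (auto simp: A_def intro!: mult_nonneg_nonneg divide_nonneg_nonneg Gamma_real_nonneg)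
  have "(\<integral>\<^sup>+p. ennreal (neg_binomial_mass r p x * mixing_density r s p) *
      indicator {0<..<1} p \<partial>lborel) = (\<integral>\<^sup>+p. ennreal A * (ennreal (p ^ x *
       (LINT w:{p<..<1}|lborel. mixing_kernel r s p w)) * indicator {0<..<1} p) \<partial>lborel)"
  proof (intro nn_integral_cong)
    fix p :: real
    show "ennreal (neg_binomial_mass r p x * mixing_density r s p) * indicator {0<..<1} p
      = ennreal A * (ennreal (p ^ x *
       (LINT w:{p<..<1}|lborel. mixing_kernel r s p w)) * indicator {0<..<1} p)"
    proof (cases "p \<in> {0<..<1}")
      case True
      hence "neg_binomial_mass r p x * mixing_density r s p
         = A * (p ^ x * (LINT w:{p<..<1}|lborel. mixing_kernel r s p w))"
        by (simp add: neg_binomial_mass_def mixing_density_kernel A_def mult_ac)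
      then show ?thesis using True A by (simp add: ennreal_mult')
    qed auto
  qed
  also have "\<dots> = ennreal A * (\<integral>\<^sup>+p. ennreal (p ^ x *
       (LINT w:{p<..<1}|lborel. mixing_kernel r s p w)) * indicator {0<..<1} p \<partial>lborel)"
    by (rule nn_integral_cmult) measurable
  also have "\<dots> = ennreal (A * (Beta (real x + 1) (r - 1) * (Gamma s * (real x + 1) powr (- s))))"
    by (simp only: nn_integral_power_mixing_kernel[OF r s] ennreal_mult'[OF A])
  also have "A * (Beta (real x + 1) (r - 1) * (Gamma s * (real x + 1) powr (- s))) = zeta_mass s x"
  proof -
    have "r - 1 \<notin> \<int>\<^sub>\<le>\<^sub>0" using r by (auto elim!: nonpos_Ints_cases)
    hence rec: "Gamma r = (r - 1) * Gamma (r - 1)"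
      using Gamma_plus1[of "r - 1"] by simp
    have pos: "Gamma (real x + 1) > 0" "Gamma (r - 1) > 0" "Gamma (r + real x) > 0" "Gamma s > 0"
      using r s by (auto intro!: Gamma_real_pos)
    have "Beta (real x + 1) (r - 1) = Gamma (real x + 1) * Gamma (r - 1) / Gamma (r + real x)"
      by (simp add: Beta_def add.commute)
    hence "A * Beta (real x + 1) (r - 1) = 1 / (real_zeta s * Gamma s)"
      using pos[THEN less_imp_neq, symmetric] r z unfolding A_def rec by simp
    hence "A * Beta (real x + 1) (r - 1) * (Gamma s * (real x + 1) powr (- s)) = zeta_mass s x"
      using pos by (simp add: zeta_mass_def)
    then show ?thesis by (simp add: mult.assoc)
  qed
  finally show ?thesis .
qed

text \<open>
  Inserting the factor one as the sum of the Negative Binomial masses and integrating term by term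
  reduces the total mass to the sum of the Zeta masses.
\<close>

lemma nn_integral_mixing_density:
  assumes r: "1 < r" and s: "1 < s"
  shows "(\<integral>\<^sup>+p. ennreal (mixing_density r s p) * indicator {0<..<1} p \<partial>lborel) = 1"
proof -
  have "(\<integral>\<^sup>+p. ennreal (mixing_density r s p) * indicator {0<..<1} p \<partial>lborel)
     = (\<integral>\<^sup>+p. (\<Sum>x. ennreal (neg_binomial_mass r p x * mixing_density r s p) *
          indicator {0<..<1} p) \<partial>lborel)"
  proof (intro nn_integral_cong)
    fix p :: real
    show "ennreal (mixing_density r s p) * indicator {0<..<1} p
      = (\<Sum>x. ennreal (neg_binomial_mass r p x * mixing_density r s p) * indicator {0<..<1} p)"
    proof (cases "p \<in> {0<..<1}")
      case True
      have "(\<lambda>x. neg_binomial_mass r p x * mixing_density r s p) sums (1 * mixing_density r s p)"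
        using True r by (intro sums_mult2 neg_binomial_mass_sums) auto
      hence "(\<Sum>x. ennreal (neg_binomial_mass r p x * mixing_density r s p))
          = ennreal (1 * mixing_density r s p)"
        using True r s
        by (intro suminf_ennreal_eq mult_nonneg_nonneg neg_binomial_mass_nonneg mixing_density_nonneg) auto
      then show ?thesis using True by simp
    qed auto
  qed
  also have "\<dots> = (\<Sum>x. \<integral>\<^sup>+p. ennreal (neg_binomial_mass r p x * mixing_density r s p) *
          indicator {0<..<1} p \<partial>lborel)"
    by (rule nn_integral_suminf) measurable
  also have "\<dots> = (\<Sum>x. ennreal (zeta_mass s x))"
    by (simp add: nn_integral_neg_binomial_mixture[OF r s])
  also have "\<dots> = ennreal 1"
    using zeta_mass_sums(1)[OF s]
    by (intro suminf_ennreal_eq zeta_mass_sums(2)[OF s]) (simp add: zeta_mass_def)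
  finally show ?thesis by simp
qed

lemma set_integral_of_nn_integral:
  fixes f :: "real \<Rightarrow> real"
  assumes [measurable]: "f \<in> borel_measurable borel" "A \<in> sets borel"
    and nonneg: "\<And>x. x \<in> A \<Longrightarrow> 0 \<le> f x" and c: "0 \<le> c"
    and eq: "(\<integral>\<^sup>+x. ennreal (f x) * indicator A x \<partial>lborel) = ennreal c"
  shows "set_integrable lborel A f" "(LINT x:A|lborel. f x) = c"
proof -
  have "(\<integral>\<^sup>+x. ennreal (indicator A x *\<^sub>R f x) \<partial>lborel) = ennreal c"
    by (subst eq[symmetric], intro nn_integral_cong) (auto simp: indicator_def)
  hence "has_bochner_integral lborel (\<lambda>x. indicator A x *\<^sub>R f x) c"
    using nonneg c by (intro has_bochner_integral_nn_integral AE_I2) (auto simp: indicator_def)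
  then show "set_integrable lborel A f" "(LINT x:A|lborel. f x) = c"
    by (auto simp: set_integrable_def set_lebesgue_integral_def has_bochner_integral_iff)
qed

lemma neg_binomial_mixture:
  assumes r: "1 < r" and s: "1 < s"
  shows "set_integrable lborel {0<..<1} (\<lambda>p. neg_binomial_mass r p x * mixing_density r s p)"
    and "(LINT p:{0<..<1}|lborel. neg_binomial_mass r p x * mixing_density r s p) = zeta_mass s x"
proof -
  have 1: "(\<lambda>p. neg_binomial_mass r p x * mixing_density r s p) \<in> borel_measurable borel"
    by measurable
  have 2: "0 \<le> neg_binomial_mass r p x * mixing_density r s p" if "p \<in> {0<..<1}" for p
    using r that
    by (intro mult_nonneg_nonneg neg_binomial_mass_nonneg mixing_density_nonneg[OF r s]) auto
  have 3: "0 \<le> zeta_mass s x"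
    using zeta_mass_sums(1)[OF s] by (simp add: zeta_mass_def)
  note * = set_integral_of_nn_integral[OF 1 _ 2 3 nn_integral_neg_binomial_mixture[OF r s]]
  show "set_integrable lborel {0<..<1} (\<lambda>p. neg_binomial_mass r p x * mixing_density r s p)"
    by (rule *(1)) auto
  show "(LINT p:{0<..<1}|lborel. neg_binomial_mass r p x * mixing_density r s p) = zeta_mass s x"
    by (rule *(2)) auto
qed

theorem theorem2:
  fixes r s :: real
  assumes "1 < s" and "1 < r"
  shows
    "(\<forall>p\<in>{0<..<1}. set_integrable lborel {p<..<1}
        (\<lambda>w. (w - p) powr (r - 2) * (- ln w) powr (s - 1) / w powr (r - 1))) \<and>
     prob_density_on {0<..<1} (mixing_density r s) \<and>
     (\<forall>x::nat.
        set_integrable lborel {0<..<1} (\<lambda>p. neg_binomial_mass r p x * mixing_density r s p) \<and>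
        (LINT p:{0<..<1}|lborel. neg_binomial_mass r p x * mixing_density r s p) = zeta_mass s x) \<and>
     (\<forall>\<mu> :: real measure.
        prob_space \<mu> \<and> sets \<mu> = sets (restrict_space borel {0<..<1}) \<and>
        (\<forall>x::nat. (LINT p|\<mu>. neg_binomial_mass r p x) = zeta_mass s x) \<longrightarrow>
        \<mu> = density (restrict_space lborel {0<..<1}) (\<lambda>p. ennreal (mixing_density r s p)))"
proof (intro conjI allI impI ballI)
  note s = assms(1) and r = assms(2)
  fix p :: real assume "p \<in> {0<..<1}"
  then show "set_integrable lborel {p<..<1}
        (\<lambda>w. (w - p) powr (r - 2) * (- ln w) powr (s - 1) / w powr (r - 1))"
    using mixing_kernel_integrable[OF r s, of p] by (simp add: mixing_kernel_def[abs_def])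
next
  note s = assms(1) and r = assms(2)
  show "prob_density_on {0<..<1} (mixing_density r s)"
    unfolding prob_density_on_def
    using set_integral_of_nn_integral[of "mixing_density r s" "{0<..<1}" 1]
      nn_integral_mixing_density[OF r s] mixing_density_nonneg[OF r s] by auto
next
  note s = assms(1) and r = assms(2)
  fix x :: nat
  show "set_integrable lborel {0<..<1} (\<lambda>p. neg_binomial_mass r p x * mixing_density r s p)"
    and "(LINT p:{0<..<1}|lborel. neg_binomial_mass r p x * mixing_density r s p) = zeta_mass s x"
    by (rule neg_binomial_mixture[OF r s])+
next
  note s = assms(1) and r = assms(2)
  fix \<mu> :: "real measure"
  define \<nu> where "\<nu> = density (restrict_space lborel {0<..<1}) (\<lambda>p. ennreal (mixing_density r s p))"
  assume "prob_space \<mu> \<and> sets \<mu> = sets (restrict_space borel {0<..<1}) \<and>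
        (\<forall>x::nat. (LINT p|\<mu>. neg_binomial_mass r p x) = zeta_mass s x)"
  hence \<mu>: "prob_space \<mu>" "sets \<mu> = sets (restrict_space borel {0<..<1})"
    "\<And>x. (LINT p|\<mu>. neg_binomial_mass r p x) = zeta_mass s x" by auto
  have meas: "f \<in> borel_measurable (restrict_space lborel {0<..<1})"
    if "f \<in> borel_measurable borel" for f :: "real \<Rightarrow> real"
    using that by (intro measurable_restrict_space1) simp
  have sets\<nu>: "sets \<nu> = sets (restrict_space borel {0<..<1})"
    by (simp add: \<nu>_def sets_restrict_space)
  have "emeasure \<nu> (space \<nu>) = (\<integral>\<^sup>+p. ennreal (mixing_density r s p) \<partial>restrict_space lborel {0<..<1})"
    unfolding \<nu>_def using meas[of "mixing_density r s"]
    by (subst emeasure_density)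
       (auto intro!: nn_integral_cong simp: indicator_def space_restrict_space sets_restrict_space)
  also have "\<dots> = 1"
    by (subst nn_integral_restrict_space) (auto simp: nn_integral_mixing_density[OF r s])
  finally have prob\<nu>: "prob_space \<nu>" by (rule prob_spaceI)
  have nb\<nu>: "(LINT p|\<nu>. neg_binomial_mass r p x) = zeta_mass s x" for x
  proof -
    have "(LINT p|\<nu>. neg_binomial_mass r p x)
       = (LINT p|restrict_space lborel {0<..<1}. mixing_density r s p *\<^sub>R neg_binomial_mass r p x)"
      unfolding \<nu>_def using mixing_density_nonneg[OF r s] by (intro integral_density meas) auto
    also have "\<dots> = (LINT p:{0<..<1}|lborel. neg_binomial_mass r p x * mixing_density r s p)"
      by (subst integral_restrict_space) (auto simp: set_lebesgue_integral_def mult_ac)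
    also have "\<dots> = zeta_mass s x"
      by (rule neg_binomial_mixture(2)[OF r s])
    finally show ?thesis .
  qed
  have "\<mu> = \<nu>"
  proof (rule unit_interval_measure_eqI_weighted_moments[where h = "\<lambda>p. (1 - p) powr r"])
    fix n :: nat
    \<comment> \<open>the constant by which the mixture equation differs from a weighted moment\<close>
    define A where "A = Gamma (r + real n) / (Gamma r * Gamma (real n + 1))"
    have "A > 0"
      unfolding A_def using r by (intro divide_pos_pos mult_pos_pos Gamma_real_pos) auto
    hence A: "A \<noteq> 0" by simp
    have nb: "neg_binomial_mass r p n = A * (p ^ n * (1 - p) powr r)" for p
      by (simp add: neg_binomial_mass_def A_def)
    show "(LINT p|\<mu>. p ^ n * (1 - p) powr r) = (LINT p|\<nu>. p ^ n * (1 - p) powr r)"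
      using \<mu>(3)[of n] nb\<nu>[of n] A unfolding nb integral_mult_right_zero
      by (metis mult_left_cancel)
  next
    fix p :: real assume "0 < p" "p < 1"
    then show "0 < (1 - p) powr r" "(1 - p) powr r \<le> 1"
      using r by (simp_all add: powr_le1)
  next
    show "(\<lambda>p. (1 - p) powr r) \<in> borel_measurable borel" by measurable
  qed (fact \<mu>(1) prob\<nu> \<mu>(2) sets\<nu>)+
  then show "\<mu> = density (restrict_space lborel {0<..<1}) (\<lambda>p. ennreal (mixing_density r s p))"
    by (simp add: \<nu>_def)
qed

end
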